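(* Let $p\geq1$ and let $a_i,b_i>0$ be such that $$b_i>\frac{a_i-1+\sqrt{(a_i+1)^2+4a_i(e-1)(a_i+1)}}{2}\qquad\text{for } 1\leq i\leq p.$$ Then the normalized hypergeometric function $${}_p\tilde{F}_{p+1}\left[{a_1,\dots,a_p\atop 2,b_1,\dots,b_p}\Big|z\right]=z\;{}_pF_{p+1}\left[{a_1,\dots,a_p\atop 2,b_1,\dots,b_p}\Big|z\right]$$ is convex in $\mathcal{D}_{1/2}=\{z\in\mathbb{C}:|z|<1/2\}$.
   Context: ${}_pF_q\left[{a_1,\dots,a_p\atop b_1,\dots,b_q}\big|z\right]=\sum_{k=0}^\infty\frac{(a_1)_k\cdots(a_p)_k}{(b_1)_k\cdots(b_q)_k}\frac{z^k}{k!}$ is the generalized hypergeometric function, with $(a)_k=\Gamma(a+k)/\Gamma(a)$. A function $f(z)=z+\sum_{k\ge2}c_kz^k$ analytic in the unit disc is convex in $\mathcal{D}_{1/2}$ if it is univalent in $\mathcal{D}_{1/2}$ and $f(\mathcal{D}_{1/2})$ is a convex domain; equivalently $\Re\left(1+zf''(z)/f'(z)\right)>0$ for $|z|<1/2$. Here $e=\exp(1)$. *)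

theory Defs
  imports "HOL-Analysis.Analysis"
begin

text \<open>
  The generalized hypergeometric function as the sum of the formal series \<^term>\<open>fps_hypergeo\<close>;
  the last argument of the latter is a scaling factor for the variable, here 1.
\<close>
definition pFq :: "complex list \<Rightarrow> complex list \<Rightarrow> complex \<Rightarrow> complex" where
  "pFq as bs z = eval_fps (fps_hypergeo as bs 1) z"

lemma foldl_mult_eq_prod_list:
  "foldl (\<lambda>r x. r * g x) (c :: 'a :: comm_monoid_mult) xs = c * prod_list (map g xs)"
  by (induction xs arbitrary: c) (simp_all add: mult.assoc)

lemma pFq_series:
  "pFq as bs z = (\<Sum>k. (\<Prod>a\<leftarrow>as. pochhammer a k) / (\<Prod>b\<leftarrow>bs. pochhammer b k) * (z ^ k / fact k))"
  unfolding pFq_def eval_fps_def by (simp add: foldl_mult_eq_prod_list)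

definition pFq_normalized :: "complex list \<Rightarrow> complex list \<Rightarrow> complex \<Rightarrow> complex" where
  "pFq_normalized as bs z = z * pFq as bs z"

text \<open>
  The first three conditions say that \<open>f(z) = z + c\<^sub>2 z\<^sup>2 + \<dots>\<close> is analytic in the unit disc.
  A convex domain is an open convex set; it is nonempty for \<open>r > 0\<close>.
\<close>
definition convex_in_disc :: "(complex \<Rightarrow> complex) \<Rightarrow> real \<Rightarrow> bool" where
  "convex_in_disc f r \<longleftrightarrow>
     f analytic_on ball 0 1 \<and> f 0 = 0 \<and> deriv f 0 = 1 \<and>
     inj_on f (ball 0 r) \<and> open (f ` ball 0 r) \<and> convex (f ` ball 0 r)"

end

theory Submission
  imports Defs "HOL-Complex_Analysis.Conformal_Mappings"
begin

text \<open>
  Write \<open>f z = z + g z\<close>. If \<open>g\<close> is \<open>L\<close>-Lipschitz on the disc of radius \<open>r\<close> with \<open>L < 1\<close> and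
  \<open>r \<bar>g''\<bar> \<le> 1 - L\<close> there, then \<open>f\<close> maps the disc injectively onto a convex set: given \<open>z\<^sub>1\<close>, \<open>z\<^sub>2\<close>
  and weights \<open>u + v = 1\<close>, the contraction \<open>z \<mapsto> u f z\<^sub>1 + v f z\<^sub>2 - g z\<close> has a fixed point at distance
  at most \<open>\<delta> = u v \<bar>z\<^sub>1 - z\<^sub>2\<bar>\<^sup>2 / (2 r)\<close> from \<open>u z\<^sub>1 + v z\<^sub>2\<close>, and strict convexity of the disc leaves
  room for exactly this \<open>\<delta>\<close>. For a power series the two bounds on \<open>g\<close> follow from
  \<open>\<Sum>n\<ge>2. n\<^sup>2 \<bar>c\<^sub>n\<bar> r\<^sup>n\<^sup>-\<^sup>1 \<le> 1\<close>.

  In the hypergeometric case the hypothesis on \<open>a\<^sub>i\<close>, \<open>b\<^sub>i\<close> says that \<open>x + (e - 1) y < 1\<close> for the ratios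
  \<open>x = (a\<^sub>i)\<^sub>1 / (b\<^sub>i)\<^sub>1\<close> and \<open>y = (a\<^sub>i)\<^sub>2 / (b\<^sub>i)\<^sub>2\<close> of Pochhammer symbols, while for \<open>r = 1/2\<close> the
  coefficient sum is at most \<open>x + (e - 2) y\<close>.
\<close>

section \<open>Small perturbations of the identity on a ball\<close>

text \<open>This is Stewart's theorem. The subtracted term measures the strict convexity of balls:
  it says how far inside the sphere a point of a chord lies.\<close>

lemma norm_convex_combination_sqr:
  fixes x y :: "'a :: real_inner"
  assumes "u + v = 1"
  shows "(norm (u *\<^sub>R x + v *\<^sub>R y))\<^sup>2 = u * (norm x)\<^sup>2 + v * (norm y)\<^sup>2 - u * v * (norm (x - y))\<^sup>2"
proof -
  have v: "v = 1 - u" using assms by simp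
  show ?thesis
    unfolding v power2_norm_eq_inner
    by (simp add: inner_commute algebra_simps)
qed

text \<open>The constant in \<open>taylor\<close> is half of the bound \<open>(1 - L) / r\<close> on
  the second derivative. It is chosen so that the contraction moves \<open>m\<close> by at most
  \<open>(1 - L) * \<delta>\<close>, which keeps \<open>cball m \<delta>\<close> invariant.\<close>

lemma convex_image_ball_perturbed_identity:
  fixes g :: "'a :: {real_inner, banach} \<Rightarrow> 'a"
  assumes r: "0 < r" and L: "0 \<le> L" "L < 1"
    and linear: "\<And>w. w \<in> ball 0 r \<Longrightarrow> linear (g' w)"
    and lipschitz: "\<And>z w. z \<in> ball 0 r \<Longrightarrow> w \<in> ball 0 r \<Longrightarrow> norm (g z - g w) \<le> L * norm (z - w)"
    and taylor: "\<And>z w. z \<in> ball 0 r \<Longrightarrow> w \<in> ball 0 r \<Longrightarrow>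
      norm (g z - g w - g' w (z - w)) \<le> (1 - L) / (2 * r) * (norm (z - w))\<^sup>2"
  shows "inj_on (\<lambda>z. z + g z) (ball 0 r)" and "convex ((\<lambda>z. z + g z) ` ball 0 r)"
proof -
  show "inj_on (\<lambda>z. z + g z) (ball 0 r)"
  proof (rule inj_onI)
    fix z w assume z: "z \<in> ball 0 r" and w: "w \<in> ball 0 r" and eq: "z + g z = w + g w"
    have "z - w = - (g z - g w)" using eq by (simp add: algebra_simps)
    then have "norm (z - w) = norm (g z - g w)" by (metis norm_minus_cancel)
    also have "\<dots> \<le> L * norm (z - w)" by (rule lipschitz[OF z w])
    finally have "(1 - L) * norm (z - w) \<le> 0" by (simp add: algebra_simps)
    with L(2) have "norm (z - w) \<le> 0" by (simp add: mult_le_0_iff)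
    then show "z = w" by simp
  qed
  show "convex ((\<lambda>z. z + g z) ` ball 0 r)"
  proof (rule convexI)
    fix f1 f2 :: 'a and u v :: real
    assume "f1 \<in> (\<lambda>z. z + g z) ` ball 0 r" "f2 \<in> (\<lambda>z. z + g z) ` ball 0 r"
      and uv: "0 \<le> u" "0 \<le> v" "u + v = 1"
    then obtain z1 z2 where z1: "z1 \<in> ball 0 r" "f1 = z1 + g z1"
      and z2: "z2 \<in> ball 0 r" "f2 = z2 + g z2" by auto
    define m where "m = u *\<^sub>R z1 + v *\<^sub>R z2"
    define \<delta> where "\<delta> = u * v * (norm (z1 - z2))\<^sup>2 / (2 * r)"
    have \<delta>0: "0 \<le> \<delta>" using uv r by (simp add: \<delta>_def)
    have m: "m \<in> ball 0 r"
      unfolding m_def using z1(1) z2(1) uv by (intro convexD[OF convex_ball])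
    have \<delta>r: "u * v * (norm (z1 - z2))\<^sup>2 = 2 * r * \<delta>" using r by (simp add: \<delta>_def)
    have sq: "(norm z1)\<^sup>2 < r\<^sup>2" "(norm z2)\<^sup>2 < r\<^sup>2"
      using z1(1) z2(1) r by (auto intro!: power_strict_mono)
    have "u * (norm z1)\<^sup>2 + v * (norm z2)\<^sup>2 < r\<^sup>2"
      using convex_bound_lt[OF sq uv] by simp
    then have "(norm m)\<^sup>2 < r\<^sup>2 - 2 * r * \<delta>"
      unfolding m_def norm_convex_combination_sqr[OF uv(3)] \<delta>r by simp
    then have m_sq: "(norm m)\<^sup>2 < r * (r - 2 * \<delta>)" by (simp add: power2_eq_square algebra_simps)
    then have "0 < r * (r - 2 * \<delta>)" using zero_le_power2[of "norm m"] by linarith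
    then have \<delta>_lt: "2 * \<delta> < r" using r by (simp add: zero_less_mult_iff)
    \<comment> \<open>Completing the square turns the bound on \<open>(norm m)\<^sup>2\<close> into
      \<open>norm m < r - \<delta>\<close>, so the closed ball of radius \<open>\<delta>\<close>
      around \<open>m\<close> stays inside the disc. Taking the root needs
      \<open>r - \<delta>\<close> to be nonnegative, hence \<open>\<delta>_lt\<close>.\<close>
    have "r * (r - 2 * \<delta>) = (r - \<delta>)\<^sup>2 - \<delta>\<^sup>2"
      by (simp add: power2_eq_square algebra_simps)
    with m_sq have "(norm m)\<^sup>2 < (r - \<delta>)\<^sup>2"
      using zero_le_power2[of \<delta>] by linarith
    then have m_lt: "norm m < r - \<delta>"
      by (rule power2_less_imp_less) (use \<delta>0 \<delta>_lt in linarith)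
    have sub: "cball m \<delta> \<subseteq> ball 0 r"
    proof
      fix z assume "z \<in> cball m \<delta>"
      then have "norm (z - m) \<le> \<delta>" by (simp add: dist_norm norm_minus_commute)
      with m_lt norm_triangle_ineq[of "z - m" m] show "z \<in> ball 0 r" by simp
    qed
    define T where "T z = u *\<^sub>R f1 + v *\<^sub>R f2 - g z" for z
    have d1: "z1 - m = v *\<^sub>R (z1 - z2)"
    proof -
      have v: "v = 1 - u" using uv(3) by simp
      show ?thesis unfolding m_def v by (simp add: algebra_simps)
    qed
    have d2: "z2 - m = (- u) *\<^sub>R (z1 - z2)"
    proof -
      have u: "u = 1 - v" using uv(3) by simp
      show ?thesis unfolding m_def u by (simp add: algebra_simps)
    qed
    interpret lin: linear "g' m" by (rule linear[OF m])
    \<comment> \<open>The weighted displacements \<open>u *\<^sub>R (z1 - m)\<close> and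
      \<open>v *\<^sub>R (z2 - m)\<close> cancel, so the linear terms vanish and only second-order
      remainders are left.\<close>
    have "T m - m = u *\<^sub>R (g z1 - g m - g' m (z1 - m)) + v *\<^sub>R (g z2 - g m - g' m (z2 - m))"
    proof -
      have v: "v = 1 - u" using uv(3) by simp
      have "u *\<^sub>R g' m (z1 - m) + v *\<^sub>R g' m (z2 - m) = 0"
        unfolding d1 d2 lin.scale by (simp add: mult.commute)
      moreover have "u *\<^sub>R (g z1 - g m - g' m (z1 - m)) + v *\<^sub>R (g z2 - g m - g' m (z2 - m))
        = u *\<^sub>R (g z1 - g m) + v *\<^sub>R (g z2 - g m) - (u *\<^sub>R g' m (z1 - m) + v *\<^sub>R g' m (z2 - m))"
        by (simp add: algebra_simps)
      ultimately have "u *\<^sub>R (g z1 - g m - g' m (z1 - m)) + v *\<^sub>R (g z2 - g m - g' m (z2 - m))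
        = u *\<^sub>R (g z1 - g m) + v *\<^sub>R (g z2 - g m)"
        by (metis diff_zero)
      also have "\<dots> = T m - m"
        unfolding T_def m_def z1(2) z2(2) by (simp add: v algebra_simps)
      finally show ?thesis by simp
    qed
    also have "norm \<dots> \<le> u * norm (g z1 - g m - g' m (z1 - m)) + v * norm (g z2 - g m - g' m (z2 - m))"
      by (rule order_trans[OF norm_triangle_ineq]) (use uv in simp)
    also have "\<dots> \<le> u * ((1 - L) / (2 * r) * (norm (z1 - m))\<^sup>2) + v * ((1 - L) / (2 * r) * (norm (z2 - m))\<^sup>2)"
      by (intro add_mono mult_left_mono taylor z1 z2 m uv)
    \<comment> \<open>The displacements have lengths \<open>v\<close> and \<open>u\<close> times
      \<open>norm (z1 - z2)\<close>, and
      \<open>u * v\<^sup>2 + v * u\<^sup>2 = (u + v) * (u * v)\<close>.\<close>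
    also have "\<dots> = (1 - L) * ((u + v) * (u * v * (norm (z1 - z2))\<^sup>2) / (2 * r))"
      unfolding d1 d2 norm_scaleR power_mult_distrib power2_abs power2_minus
      using r by (simp add: power2_eq_square field_simps)
    also have "\<dots> = (1 - L) * \<delta>" by (simp add: uv(3) \<delta>_def)
    finally have T_m: "norm (T m - m) \<le> (1 - L) * \<delta>" .
    have T_lip: "dist (T z) (T w) \<le> L * dist z w" if "z \<in> ball 0 r" "w \<in> ball 0 r" for z w
      using lipschitz[OF that(2,1)] by (simp add: T_def dist_norm norm_minus_commute)
    have "\<exists>!z\<in>cball m \<delta>. T z = z"
    proof (rule Banach_fix)
      show "complete (cball m \<delta>)" by (simp add: complete_eq_closed)
      show "cball m \<delta> \<noteq> {}" using \<delta>0 by auto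
      show "0 \<le> L" "L < 1" by fact+
      show "T ` cball m \<delta> \<subseteq> cball m \<delta>"
      proof (rule image_subsetI)
        fix z assume z: "z \<in> cball m \<delta>"
        have "dist m (T z) \<le> dist m (T m) + dist (T m) (T z)" by (rule dist_triangle)
        also have "\<dots> \<le> (1 - L) * \<delta> + L * dist m z"
          using T_m T_lip[OF m subsetD[OF sub z]] by (simp add: dist_norm norm_minus_commute)
        also have "\<dots> \<le> (1 - L) * \<delta> + L * \<delta>"
          using z L(1) by (intro add_left_mono mult_left_mono) auto
        finally show "T z \<in> cball m \<delta>" by (simp add: algebra_simps)
      qed
      show "dist (T z) (T w) \<le> L * dist z w" if "z \<in> cball m \<delta>" "w \<in> cball m \<delta>" for z w
        using T_lip sub that by blast
    qed
    then obtain z where "z \<in> cball m \<delta>" "T z = z" by blast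
    then have "z \<in> ball 0 r" "u *\<^sub>R f1 + v *\<^sub>R f2 = z + g z"
      using sub by (auto simp: T_def algebra_simps)
    then show "u *\<^sub>R f1 + v *\<^sub>R f2 \<in> (\<lambda>z. z + g z) ` ball 0 r" by blast
  qed
qed

section \<open>A coefficient criterion for convexity of power series\<close>

lemma norm_power_diff_le:
  fixes z w :: "'a :: real_normed_field"
  assumes "norm z \<le> r" "norm w \<le> r"
  shows "norm (z ^ Suc n - w ^ Suc n) \<le> real (Suc n) * r ^ n * norm (z - w)"
proof (induction n)
  case (Suc n)
  have r: "0 \<le> r" using assms(1) norm_ge_zero order_trans by blast
  have "z ^ Suc (Suc n) - w ^ Suc (Suc n) = z * (z ^ Suc n - w ^ Suc n) + w ^ Suc n * (z - w)"
    by (simp add: algebra_simps)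
  also have "norm \<dots> \<le> norm z * norm (z ^ Suc n - w ^ Suc n) + norm w ^ Suc n * norm (z - w)"
    by (rule order_trans[OF norm_triangle_ineq]) (simp add: norm_mult norm_power)
  also have "\<dots> \<le> r * (real (Suc n) * r ^ n * norm (z - w)) + r ^ Suc n * norm (z - w)"
    using assms r by (intro add_mono mult_mono Suc.IH power_mono) auto
  finally show ?case by (simp add: algebra_simps)
qed simp

text \<open>The factor on the right is half the maximum of the second derivative of the power on the
  disc of radius \<open>r\<close>. Multiplying the remainder by \<open>z\<close> gives the next one
  up to a term in \<open>(z - w)\<^sup>2\<close>, so induction suffices.\<close>

lemma norm_power_taylor_le:
  fixes z w :: "'a :: real_normed_field"
  assumes "norm z \<le> r" "norm w \<le> r"
  shows "norm (z ^ (n + 2) - w ^ (n + 2) - of_nat (n + 2) * w ^ Suc n * (z - w))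
    \<le> real ((n + 2) * (n + 1)) / 2 * r ^ n * (norm (z - w))\<^sup>2"
proof (induction n)
  case 0
  have "z ^ 2 - w ^ 2 - 2 * w * (z - w) = (z - w)\<^sup>2"
    by (simp add: power2_eq_square algebra_simps)
  then show ?case by (simp add: norm_mult power2_eq_square)
next
  case (Suc n)
  have r: "0 \<le> r" using assms(1) norm_ge_zero order_trans by blast
  have "z ^ (Suc n + 2) - w ^ (Suc n + 2) - of_nat (Suc n + 2) * w ^ Suc (Suc n) * (z - w)
    = z * (z ^ (n + 2) - w ^ (n + 2) - of_nat (n + 2) * w ^ Suc n * (z - w))
      + of_nat (n + 2) * w ^ Suc n * (z - w)\<^sup>2"
    by (simp add: power2_eq_square algebra_simps)
  also have "norm \<dots> \<le> norm z * norm (z ^ (n + 2) - w ^ (n + 2) - of_nat (n + 2) * w ^ Suc n * (z - w))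
      + real (n + 2) * norm w ^ Suc n * (norm (z - w))\<^sup>2"
    by (rule order_trans[OF norm_triangle_ineq])
      (simp only: norm_mult norm_power norm_of_nat order.refl)
  also have "\<dots> \<le> r * (real ((n + 2) * (n + 1)) / 2 * r ^ n * (norm (z - w))\<^sup>2)
      + real (n + 2) * r ^ Suc n * (norm (z - w))\<^sup>2"
    using assms r by (intro add_mono mult_mono Suc.IH power_mono order_refl) auto
  also have "\<dots> = real ((Suc n + 2) * (Suc n + 1)) / 2 * r ^ Suc n * (norm (z - w))\<^sup>2"
    by (simp add: field_simps)
  finally show ?case .
qed

text \<open>Splitting \<open>n\<^sup>2 = n + n * (n - 1)\<close> divides the coefficient sum into a
  Lipschitz constant for the part of order at least 2 and \<open>r\<close> times a bound on its
  second derivative.\<close>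

lemma convex_in_disc_eval_fps:
  fixes F :: "complex fps"
  assumes F: "1 \<le> fps_conv_radius F" "fps_nth F 0 = 0" "fps_nth F 1 = 1"
    and r: "0 < r" "r \<le> 1"
    and summable: "summable (\<lambda>k. (real (k + 2))\<^sup>2 * norm (fps_nth F (k + 2)) * r ^ (k + 1))"
    and suminf: "(\<Sum>k. (real (k + 2))\<^sup>2 * norm (fps_nth F (k + 2)) * r ^ (k + 1)) \<le> 1"
  shows "convex_in_disc (eval_fps F) r"
proof -
  define c where "c k = fps_nth F (k + 2)" for k
  define Lt where "Lt k = real (k + 2) * norm (c k) * r ^ (k + 1)" for k
  define Mt where "Mt k = real ((k + 2) * (k + 1)) * norm (c k) * r ^ (k + 1)" for k
  define L where "L = (\<Sum>k. Lt k)"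
  have Ct: "(real (k + 2))\<^sup>2 * norm (fps_nth F (k + 2)) * r ^ (k + 1) = Lt k + Mt k" for k
    by (simp add: Lt_def Mt_def c_def power2_eq_square algebra_simps)
  have nonneg: "0 \<le> Lt k" "0 \<le> Mt k" for k using r by (simp_all add: Lt_def Mt_def)
  have Lt_le_Mt: "Lt k \<le> Mt k" for k
    unfolding Lt_def Mt_def using r by (intro mult_right_mono) (auto simp flip: of_nat_mult)
  have sumL: "summable Lt" and sumM: "summable Mt"
    using summable nonneg unfolding Ct by (auto intro: summable_comparison_test')
  have LM: "L + (\<Sum>k. Mt k) \<le> 1"
    using suminf unfolding Ct L_def suminf_add[OF sumL sumM] .
  \<comment> \<open>Together with \<open>LM\<close> this even gives \<open>L \<le> 1 / 2\<close>, so
    the contraction is strict also when the coefficient sum equals 1.\<close>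
  have "L \<le> (\<Sum>k. Mt k)" unfolding L_def by (intro suminf_le Lt_le_Mt sumL sumM)
  with LM have L1: "L < 1" by linarith
  have L0: "0 \<le> L" unfolding L_def by (intro suminf_nonneg sumL nonneg)

  have conv: "ereal (norm z) < fps_conv_radius F" if "z \<in> ball 0 1" for z :: complex
    using that F(1) by (metis ereal_less_eq(3) less_le_trans mem_ball_0 not_le one_ereal_def order_less_le_trans)
  define g where "g z = eval_fps F z - z" for z
  have g_sums: "(\<lambda>k. c k * z ^ (k + 2)) sums g z" if "z \<in> ball 0 r" for z
  proof -
    have "(\<lambda>k. fps_nth F k * z ^ k) sums eval_fps F z"
      using that r by (intro sums_eval_fps conv) auto
    from sums_split_initial_segment[OF this, of 2] F show ?thesis
      by (simp add: g_def c_def numeral_2_eq_2)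
  qed
  define g' where "g' w = (\<Sum>k. of_nat (k + 2) * c k * w ^ (k + 1))" for w :: complex
  have g'_sums: "(\<lambda>k. of_nat (k + 2) * c k * w ^ (k + 1)) sums g' w" if "w \<in> ball 0 r" for w
    unfolding g'_def
  proof (rule summable_sums, rule summable_comparison_test'[OF sumL])
    show "norm (of_nat (k + 2) * c k * w ^ (k + 1)) \<le> Lt k" for k
      unfolding Lt_def norm_mult norm_power norm_of_nat using that r
      by (intro mult_left_mono power_mono) auto
  qed
  have lip: "norm (g z - g w) \<le> L * norm (z - w)" if z: "z \<in> ball 0 r" and w: "w \<in> ball 0 r" for z w
  proof -
    have "(\<lambda>k. c k * z ^ (k + 2) - c k * w ^ (k + 2)) sums (g z - g w)"
      by (intro sums_diff g_sums z w)
    moreover have "norm (c k * z ^ (k + 2) - c k * w ^ (k + 2)) \<le> Lt k * norm (z - w)" for k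
    proof -
      have "norm (c k * z ^ (k + 2) - c k * w ^ (k + 2)) = norm (c k) * norm (z ^ Suc (k + 1) - w ^ Suc (k + 1))"
        by (simp flip: norm_mult add: algebra_simps)
      also have "\<dots> \<le> norm (c k) * (real (Suc (k + 1)) * r ^ (k + 1) * norm (z - w))"
        using z w by (intro mult_left_mono norm_power_diff_le) auto
      finally show ?thesis by (simp add: Lt_def algebra_simps)
    qed
    moreover have "(\<lambda>k. Lt k * norm (z - w)) sums (L * norm (z - w))"
      unfolding L_def by (intro sums_mult2 summable_sums sumL)
    ultimately show ?thesis
      using norm_suminf_le[of "\<lambda>k. c k * z ^ (k + 2) - c k * w ^ (k + 2)" "\<lambda>k. Lt k * norm (z - w)"]
      by (simp add: sums_iff)
  qed
  have taylor: "norm (g z - g w - g' w * (z - w)) \<le> (1 - L) / (2 * r) * (norm (z - w))\<^sup>2"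
    if z: "z \<in> ball 0 r" and w: "w \<in> ball 0 r" for z w
  proof -
    let ?R = "\<lambda>k. c k * z ^ (k + 2) - c k * w ^ (k + 2) - of_nat (k + 2) * c k * w ^ (k + 1) * (z - w)"
    let ?D = "(norm (z - w))\<^sup>2 / (2 * r)"
    have "?R sums (g z - g w - g' w * (z - w))"
      by (intro sums_diff sums_mult2 g_sums g'_sums z w)
    moreover have "norm (?R k) \<le> Mt k * ?D" for k
    proof -
      have "norm (?R k) = norm (c k) * norm (z ^ (k + 2) - w ^ (k + 2) - of_nat (k + 2) * w ^ Suc k * (z - w))"
        by (simp flip: norm_mult add: algebra_simps)
      also have "\<dots> \<le> norm (c k) * (real ((k + 2) * (k + 1)) / 2 * r ^ k * (norm (z - w))\<^sup>2)"
        using z w by (intro mult_left_mono norm_power_taylor_le) auto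
      also have "\<dots> = Mt k * ?D" using r by (simp add: Mt_def field_simps)
      finally show ?thesis .
    qed
    moreover have "(\<lambda>k. Mt k * ?D) sums ((\<Sum>k. Mt k) * ?D)"
      by (intro sums_mult2 summable_sums sumM)
    ultimately have "norm (g z - g w - g' w * (z - w)) \<le> (\<Sum>k. Mt k) * ?D"
      using norm_suminf_le[of ?R "\<lambda>k. Mt k * ?D"] by (simp add: sums_iff)
    also have "\<dots> \<le> (1 - L) * ?D" using LM r by (intro mult_right_mono) auto
    finally show ?thesis by simp
  qed
  have g_eq: "(\<lambda>z. z + g z) = eval_fps F" by (simp add: g_def)
  have inj: "inj_on (eval_fps F) (ball 0 r)" and convex: "convex (eval_fps F ` ball 0 r)"
    using convex_image_ball_perturbed_identity[OF r(1) L0 L1 _ lip taylor]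
    unfolding g_eq by (auto simp: linear_times)
  have analytic: "eval_fps F analytic_on ball 0 1"
    using conv by (intro analytic_on_eval_fps) (auto simp: in_eball_iff)
  have "(eval_fps F has_field_derivative eval_fps (fps_deriv F) 0) (at 0)"
    by (intro has_field_derivative_eval_fps conv) auto
  then have "deriv (eval_fps F) 0 = 1"
    using F(3) by (simp add: DERIV_imp_deriv eval_fps_at_0)
  moreover have "open (eval_fps F ` ball 0 r)"
    using inj r by (intro open_mapping_thm3 holomorphic_on_subset[OF analytic_imp_holomorphic[OF analytic]]) auto
  ultimately show ?thesis
    unfolding convex_in_disc_def using analytic inj convex F(2) by (simp add: eval_fps_at_0)
qed

section \<open>Pochhammer ratios and the hypothesis on the parameters\<close>

lemma prod_list_map_upt: "prod_list (map f [m..<n]) = prod f {m..<n}"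
  for f :: "nat \<Rightarrow> 'a :: comm_monoid_mult"
  using prod.distinct_set_conv_list[of "[m..<n]" f] by simp

lemma pochhammer_2: "pochhammer 2 k = (fact (Suc k) :: 'a :: {comm_semiring_1, semiring_char_0})"
  by (simp add: pochhammer_fact pochhammer_rec)

lemma pochhammer_ratio_antimono:
  fixes a b :: real
  assumes "0 < a" "a \<le> b" "m \<le> n"
  shows "pochhammer a n / pochhammer b n \<le> pochhammer a m / pochhammer b m"
  using assms(3)
proof (induction rule: dec_induct)
  case (step n)
  have "pochhammer a (Suc n) / pochhammer b (Suc n)
    = pochhammer a n / pochhammer b n * ((a + n) / (b + n))"
    by (simp add: pochhammer_Suc)
  also have "\<dots> \<le> pochhammer a n / pochhammer b n"
    using assms by (intro mult_right_le_one_le divide_nonneg_pos less_imp_le[OF pochhammer_pos] pochhammer_pos) auto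
  finally show ?case using step.IH by simp
qed simp

text \<open>The lower bound on \<open>b\<close> is the larger root of the quadratic
  \<open>(b - a) * (b + 1) - (exp 1 - 1) * a * (a + 1)\<close> in \<open>b\<close>, which is
  therefore positive. Dividing by \<open>b * (b + 1)\<close> gives the second claim.\<close>

lemma condition_imp_ratio_bound:
  fixes a b :: real
  assumes a: "0 < a" and
    b: "b > (a - 1 + sqrt ((a + 1)\<^sup>2 + 4 * a * (exp 1 - 1) * (a + 1))) / 2"
  shows "a < b" and
    "pochhammer a 1 / pochhammer b 1 + (exp 1 - 1) * (pochhammer a 2 / pochhammer b 2) < 1"
proof -
  let ?D = "(a + 1)\<^sup>2 + 4 * a * (exp 1 - 1) * (a + 1)"
  have e: "(1 :: real) < exp 1" by simp
  have D: "(a + 1)\<^sup>2 \<le> ?D" using a e by simp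
  then have "a + 1 \<le> sqrt ?D" using a by (intro real_le_rsqrt)
  with b show ab: "a < b" by (simp add: field_simps)
  have "sqrt ?D < 2 * b - a + 1" using b by (simp add: field_simps)
  then have "(sqrt ?D)\<^sup>2 < (2 * b - a + 1)\<^sup>2"
    using D by (intro power_strict_mono) auto
  then have "?D < (2 * b - a + 1)\<^sup>2" using D zero_le_power2[of "a + 1"] by simp
  then have *: "(exp 1 - 1) * a * (a + 1) < (b - a) * (b + 1)"
    by (simp add: power2_eq_square algebra_simps)
  have p: "pochhammer x 2 = x * (x + 1)" for x :: real
    by (simp add: numeral_2_eq_2 pochhammer_Suc)
  have "(exp 1 - 1) * a * (a + 1) / (b + 1) < b - a"
    using * a ab by (subst pos_divide_less_eq) auto
  then have "(exp 1 - 1) * a * (a + 1) / (b + 1) / b < (b - a) / b"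
    using a ab by (intro divide_strict_right_mono) auto
  then have "(exp 1 - 1) * (a * (a + 1) / (b * (b + 1))) < (b - a) / b"
    by (simp add: mult_ac)
  also have "\<dots> = 1 - a / b" using a ab by (simp add: field_simps)
  finally show "pochhammer a 1 / pochhammer b 1 + (exp 1 - 1) * (pochhammer a 2 / pochhammer b 2) < 1"
    by (simp add: p)
qed

theorem corollary2:
  fixes p :: nat and a b :: "nat \<Rightarrow> real"
  assumes "p \<ge> 1"
    and "\<And>i. i \<in> {1..p} \<Longrightarrow> a i > 0"
    and "\<And>i. i \<in> {1..p} \<Longrightarrow> b i > 0"
    and "\<And>i. i \<in> {1..p} \<Longrightarrow>
           b i > (a i - 1 + sqrt ((a i + 1)\<^sup>2 + 4 * a i * (exp 1 - 1) * (a i + 1))) / 2"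
  shows "convex_in_disc
           (pFq_normalized (map (\<lambda>i. complex_of_real (a i)) [1..<Suc p])
                           (2 # map (\<lambda>i. complex_of_real (b i)) [1..<Suc p])) (1 / 2)"
proof -
  let ?as = "map (\<lambda>i. complex_of_real (a i)) [1..<Suc p]"
  let ?bs = "2 # map (\<lambda>i. complex_of_real (b i)) [1..<Suc p]"
  have ab: "a i < b i" if "i \<in> {1..p}" for i
    using condition_imp_ratio_bound(1) assms(2,4) that by blast
  define A where "A k = (\<Prod>i=1..p. pochhammer (a i) k / pochhammer (b i) k)" for k
  define x where "x = pochhammer (a 1) 1 / pochhammer (b 1) 1"
  define y where "y = pochhammer (a 1) 2 / pochhammer (b 1) 2"
  have one: "1 \<in> {1..p}" using assms(1) by simp
  have xy: "x + (exp 1 - 1) * y < 1"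
    unfolding x_def y_def using condition_imp_ratio_bound(2) assms(2,4) one by blast
  have A_nonneg: "0 \<le> A k" for k
    unfolding A_def using assms(2,3)
    by (intro prod_nonneg divide_nonneg_pos less_imp_le[OF pochhammer_pos] pochhammer_pos) auto
  have ratio_nonneg: "0 \<le> pochhammer (a i) k / pochhammer (b i) k" if "i \<in> {1..p}" for i k
    using assms(2,3)[OF that] by (intro divide_nonneg_pos less_imp_le[OF pochhammer_pos] pochhammer_pos)
  have ratio_le_1: "pochhammer (a i) k / pochhammer (b i) k \<le> 1" if "i \<in> {1..p}" for i k
    using pochhammer_ratio_antimono[of "a i" "b i" 0 k] assms(2) ab that by (simp add: less_imp_le)
  \<comment> \<open>All factors lie between 0 and 1, so dropping all but the first can only increase
    the product.\<close>
  have A_le: "A k \<le> pochhammer (a 1) k / pochhammer (b 1) k" for k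
  proof -
    have "A k = pochhammer (a 1) k / pochhammer (b 1) k
        * (\<Prod>i\<in>{1..p} - {1}. pochhammer (a i) k / pochhammer (b i) k)"
      unfolding A_def using one by (subst prod.remove[of _ 1]) auto
    also have "\<dots> \<le> pochhammer (a 1) k / pochhammer (b 1) k"
      using one by (intro mult_right_le_one_le prod_nonneg prod_le_1 conjI ratio_nonneg ratio_le_1) auto
    finally show ?thesis .
  qed
  have A_le_1: "A k \<le> 1" for k using A_le[of k] ratio_le_1[OF one, of k] by linarith
  have A_le_x: "A 1 \<le> x" unfolding x_def by (rule A_le)
  have A_le_y: "A k \<le> y" if "2 \<le> k" for k
    using A_le[of k] pochhammer_ratio_antimono[of "a 1" "b 1" 2 k] assms(2) ab one that
    unfolding y_def by fastforce

  let ?H = "fps_hypergeo ?as ?bs 1"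
  \<comment> \<open>The lower parameter 2 contributes \<open>fact (Suc k)\<close>; the other
    factorial is the one in the hypergeometric series itself.\<close>
  have H_nth: "fps_nth ?H k = of_real (A k / (fact (Suc k) * fact k))" for k
  proof -
    have "fps_nth ?H k = (\<Prod>i\<leftarrow>[1..<Suc p]. pochhammer (complex_of_real (a i)) k) /
        (fact (Suc k) * (\<Prod>i\<leftarrow>[1..<Suc p]. pochhammer (complex_of_real (b i)) k) * fact k)"
      by (simp add: foldl_mult_eq_prod_list pochhammer_2 o_def del: upt_Suc fact_Suc)
    then show ?thesis
      unfolding prod_list_map_upt
      by (simp add: A_def prod_dividef atLeastLessThanSuc_atLeastAtMost pochhammer_of_real
        del: upt_Suc fact_Suc flip: of_real_prod)
  qed
  have norm_H: "norm (fps_nth ?H k) = A k / (fact (Suc k) * fact k)" for k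
    unfolding H_nth norm_of_real using A_nonneg by simp
  have conv: "fps_conv_radius ?H = \<infinity>"
    unfolding fps_conv_radius_def
  proof (rule conv_radius_inftyI'')
    fix z :: complex
    show "summable (\<lambda>k. fps_nth ?H k * z ^ k)"
    proof (rule summable_comparison_test'[OF summable_exp[of "norm z"]])
      fix k :: nat
      have "norm (fps_nth ?H k) \<le> 1 / (1 * fact k)"
        unfolding norm_H using A_le_1
        by (intro frac_le mult_right_mono) (auto simp del: fact_Suc)
      then show "norm (fps_nth ?H k * z ^ k) \<le> inverse (fact k) * norm z ^ k"
        unfolding norm_mult norm_power by (intro mult_right_mono) (auto simp: inverse_eq_divide)
    qed
  qed
  define F where "F = fps_X * ?H"
  have eval: "pFq_normalized ?as ?bs z = eval_fps F z" for z
    unfolding pFq_normalized_def pFq_def F_def using conv by (simp add: eval_fps_mult)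
  have "fps_conv_radius F = \<infinity>"
    using fps_conv_radius_mult[of fps_X ?H] conv by (simp add: F_def)
  then have conv_F: "1 \<le> fps_conv_radius F" by simp
  have norm_F: "norm (fps_nth F (k + 2)) = A (Suc k) / (fact (k + 2) * fact (Suc k))" for k
    using norm_H[of "Suc k"]
    by (simp add: F_def numeral_2_eq_2 del: fps_hypergeo_nth fact_Suc upt_Suc)
  let ?t = "\<lambda>k. (real (k + 2))\<^sup>2 * norm (fps_nth F (k + 2)) * (1 / 2) ^ (k + 1)"
  \<comment> \<open>The majorant is \<open>x\<close> for \<open>k = 0\<close> and
    \<open>y / fact (Suc k)\<close> afterwards; the conditional term corrects the first entry so
    that the rest is an exponential series.\<close>
  have t_le: "?t k \<le> y * (1 / fact (Suc k)) + (if k = 0 then x - y else 0)" for k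
  proof -
    have "?t k = A (Suc k) / fact (Suc k) * (real (k + 2) / (2 ^ (k + 1) * fact (Suc k)))"
      unfolding norm_F by (simp add: power2_eq_square power_one_over divide_simps)
    also have "\<dots> \<le> A (Suc k) / fact (Suc k)"
    proof (rule mult_right_le_one_le)
      \<comment> \<open>The radius \<open>1 / 2\<close> enters here: its powers absorb the factor
        \<open>k + 2\<close> that survives from the square after cancellation against
        \<open>fact (k + 2)\<close>.\<close>
      have "k + 2 \<le> 2 ^ (k + 1)" by (induction k) auto
      then have "k + 2 \<le> 2 ^ (k + 1) * fact (Suc k)"
        by (rule order_trans) (simp del: fact_Suc)
      then have "real (k + 2) \<le> real (2 ^ (k + 1) * fact (Suc k))" by (rule of_nat_mono)
      then show "real (k + 2) / (2 ^ (k + 1) * fact (Suc k)) \<le> 1"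
        by (simp del: fact_Suc)
    qed (auto simp: A_nonneg)
    also have "\<dots> \<le> y * (1 / fact (Suc k)) + (if k = 0 then x - y else 0)"
      using A_le_x A_le_y[of "Suc k"] by (auto intro: divide_right_mono simp del: fact_Suc)
    finally show ?thesis .
  qed
  have "(\<lambda>k. inverse (fact k) * 1 ^ k) sums exp (1::real)"
    using exp_converges[of "1::real"] by simp
  from sums_split_initial_segment[OF this, of 1]
  have "(\<lambda>k. 1 / fact (Suc k)) sums (exp 1 - 1 :: real)" by (simp add: inverse_eq_divide del: fact_Suc)
  then have bound_sums: "(\<lambda>k. y * (1 / fact (Suc k)) + (if k = 0 then x - y else 0))
      sums (y * (exp 1 - 1) + (x - y))"
    using sums_single[of 0 "\<lambda>_. x - y"] by (intro sums_add sums_mult) auto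
  have summable_t: "summable ?t"
    by (rule summable_comparison_test'[OF sums_summable[OF bound_sums]])
      (use t_le in simp)
  \<comment> \<open>The majorant sums to \<open>x + (exp 1 - 2) * y\<close>; nonnegativity of
    \<open>y\<close> puts this below \<open>x + (exp 1 - 1) * y\<close>, which \<open>xy\<close>
    bounds by 1.\<close>
  have "y \<ge> 0" unfolding y_def by (rule ratio_nonneg[OF one])
  then have "(\<Sum>k. ?t k) \<le> 1"
    using suminf_le[OF t_le summable_t sums_summable[OF bound_sums]] sums_unique[OF bound_sums] xy
    by (simp add: algebra_simps)
  moreover have "fps_nth F 0 = 0" "fps_nth F 1 = 1"
    by (simp_all add: F_def del: fps_hypergeo_nth upt_Suc)
  ultimately have "convex_in_disc (eval_fps F) (1 / 2)"
    using conv_F summable_t by (intro convex_in_disc_eval_fps) simp_all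
  then show ?thesis using eval by presburger
qed

end
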